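(* Let $h\in\mathcal{P}$ be such that the function $z\mapsto -zh(z)$ also belongs to $\mathcal{P}$. Then there exists $\varphi\in\mathcal{S}_2$ such that $\chi=(1,1)$ is a carapoint for $\varphi$, $\varphi(\chi)=1$, and $h$ is the slope function for $\varphi$ at $\chi$.
   Context: $\mathbb{D}$ is the open unit disc, $\mathbb{T}$ the unit circle, $\Pi=\{z\in\mathbb{C}:\operatorname{Im}z>0\}$. The Pick class $\mathcal{P}$ is the set of analytic functions on $\Pi$ with non-negative imaginary part. $\mathcal{S}_2$ is the set of analytic functions from $\mathbb{D}^2$ to the closed unit disc. A point $\tau\in\mathbb{T}^2$ is a carapoint for $\varphi\in\mathcal{S}_2$ if $\liminf_{\lambda\to\tau}\frac{1-|\varphi(\lambda)|}{1-\|\lambda\|_\infty}<\infty$ ($\lambda\in\mathbb{D}^2$). At a carapoint $\tau$ the function $\varphi$ has a nontangential limit, denoted $\varphi(\tau)$; here a set $S\subset\mathbb{D}^2$ approaches $\tau$ nontangentially if $\tau\in\overline{S}$ and $\|\lambda-\tau\|/\mathrm{dist}(\lambda,\partial\mathbb{D}^2)$ is bounded on $S$, and the nontangential limit is the common limit along all such sets. Put $\mathbb{H}(\tau)=\{\delta\in\mathbb{C}^2:\operatorname{Re}(\bar\tau_1\delta_1)>0,\ \operatorname{Re}(\bar\tau_2\delta_2)>0\}$, so that $\tau-t\delta\in\mathbb{D}^2$ for all small $t>0$ when $\delta\in\mathbb{H}(\tau)$. The directional derivative is $D_{-\delta}\varphi(\tau)=\lim_{t\to0+}\frac{\varphi(\tau-t\delta)-\varphi(\tau)}{t}$.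 If $h$ and $-zh$ are both in $\mathcal{P}$ then $h$ extends analytically across $(0,\infty)$, with real values there, and hence by reflection to $\mathbb{C}\setminus(-\infty,0]$; the extension is again denoted $h$. Such an $h$ is the slope function of $\varphi$ at a carapoint $\tau\in\mathbb{T}^2$ if, for all $\delta\in\mathbb{H}(\tau)$, the directional derivative exists and $$D_{-\delta}\varphi(\tau)=\varphi(\tau)\,\bar\tau_2\delta_2\,h\!\left(\frac{\bar\tau_2\delta_2}{\bar\tau_1\delta_1}\right).$$ *)

theory Defs
  imports "HOL-Complex_Analysis.Complex_Analysis"
begin

definition upper_half_plane :: "complex set" where
  "upper_half_plane = {z. Im z > 0}"

definition pick_class :: "(complex \<Rightarrow> complex) set" where
  "pick_class = {f. f holomorphic_on upper_half_plane \<and> (\<forall>z\<in>upper_half_plane. Im (f z) \<ge> 0)}"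

definition bidisc :: "(complex \<times> complex) set" where
  "bidisc = ball 0 1 \<times> ball 0 1"

definition torus2 :: "(complex \<times> complex) set" where
  "torus2 = sphere 0 1 \<times> sphere 0 1"

text \<open>Analyticity in two variables on an open set: Frechet differentiability with a
  complex-linear derivative; \<open>a\<close> and \<open>b\<close> are the two complex partial derivatives.\<close>

definition analytic2_on :: "(complex \<times> complex \<Rightarrow> complex) \<Rightarrow> (complex \<times> complex) set \<Rightarrow> bool" where
  "analytic2_on f S \<longleftrightarrow>
     (\<forall>p\<in>S. \<exists>a b. (f has_derivative (\<lambda>v. a * fst v + b * snd v)) (at p))"

definition schur_class2 :: "(complex \<times> complex \<Rightarrow> complex) set" where
  "schur_class2 = {\<phi>. analytic2_on \<phi> bidisc \<and> \<phi> ` bidisc \<subseteq> cball 0 1}"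

definition norm_inf :: "complex \<times> complex \<Rightarrow> real" where
  "norm_inf p = max (norm (fst p)) (norm (snd p))"

definition carapoint :: "(complex \<times> complex \<Rightarrow> complex) \<Rightarrow> complex \<times> complex \<Rightarrow> bool" where
  "carapoint \<phi> \<tau> \<longleftrightarrow> \<tau> \<in> torus2 \<and>
     Liminf (at \<tau> within bidisc) (\<lambda>p. ereal ((1 - norm (\<phi> p)) / (1 - norm_inf p))) < \<infinity>"

text \<open>The norm and distance are the Euclidean ones of the product type; any other norm gives
  the same approach sets.\<close>

definition approaches_nontangentially ::
    "(complex \<times> complex) set \<Rightarrow> complex \<times> complex \<Rightarrow> bool" where
  "approaches_nontangentially S \<tau> \<longleftrightarrow> S \<subseteq> bidisc \<and> \<tau> \<in> closure S \<and>
     bounded ((\<lambda>p. norm (p - \<tau>) / infdist p (frontier bidisc)) ` S)"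

definition has_nontangential_limit ::
    "(complex \<times> complex \<Rightarrow> complex) \<Rightarrow> complex \<times> complex \<Rightarrow> complex \<Rightarrow> bool" where
  "has_nontangential_limit \<phi> \<tau> w \<longleftrightarrow>
     (\<forall>S. approaches_nontangentially S \<tau> \<longrightarrow> (\<phi> \<longlongrightarrow> w) (at \<tau> within S))"

definition inward_directions :: "complex \<times> complex \<Rightarrow> (complex \<times> complex) set" where
  "inward_directions \<tau> =
     {\<delta>. Re (cnj (fst \<tau>) * fst \<delta>) > 0 \<and> Re (cnj (snd \<tau>) * snd \<delta>) > 0}"

text \<open>The derivative in direction \<open>-\<delta>\<close> at a boundary point \<open>\<tau>\<close> at which \<open>\<phi>\<close> has the
  boundary value \<open>w\<close>. The value taken by the total function \<open>\<phi>\<close> at \<open>\<tau>\<close> itself is irrelevant.\<close>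

definition has_inward_derivative ::
    "(complex \<times> complex \<Rightarrow> complex) \<Rightarrow> complex \<times> complex \<Rightarrow> complex \<Rightarrow>
     complex \<times> complex \<Rightarrow> complex \<Rightarrow> bool" where
  "has_inward_derivative \<phi> \<tau> w \<delta> D \<longleftrightarrow>
     ((\<lambda>t. (\<phi> (\<tau> - t *\<^sub>R \<delta>) - w) / of_real t) \<longlongrightarrow> D) (at_right 0)"

text \<open>The analytic extension of a function on the upper half-plane to the plane slit along
  the non-positive reals, real on the positive half-line. It is unique on the slit plane by the
  identity theorem, so \<open>g\<close> is determined there by the values of \<open>h\<close> on the upper half-plane.\<close>

definition slit_plane_extension :: "(complex \<Rightarrow> complex) \<Rightarrow> (complex \<Rightarrow> complex) \<Rightarrow> bool" where
  "slit_plane_extension h g \<longleftrightarrow> g holomorphic_on (- \<real>\<^sub>\<le>\<^sub>0) \<and>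
     (\<forall>z\<in>upper_half_plane. g z = h z) \<and> (\<forall>x>0. g (complex_of_real x) \<in> \<real>)"

definition slope_function ::
    "(complex \<Rightarrow> complex) \<Rightarrow> (complex \<times> complex \<Rightarrow> complex) \<Rightarrow> complex \<times> complex \<Rightarrow> bool" where
  "slope_function h \<phi> \<tau> \<longleftrightarrow>
     h \<in> pick_class \<and> (\<lambda>z. - z * h z) \<in> pick_class \<and> carapoint \<phi> \<tau> \<and>
     (\<exists>w g. has_nontangential_limit \<phi> \<tau> w \<and> slit_plane_extension h g \<and>
        (\<forall>\<delta>\<in>inward_directions \<tau>. has_inward_derivative \<phi> \<tau> w \<delta>
           (w * (cnj (snd \<tau>) * snd \<delta>) *
              g ((cnj (snd \<tau>) * snd \<delta>) / (cnj (fst \<tau>) * fst \<delta>)))))"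

end

theory Submission
  imports Defs
begin

text \<open>Write \<open>q = -h\<close>. The two Pick conditions say that \<open>q(z)\<close> lies in the closed convex cone
  spanned by \<open>1\<close> and \<open>1/z\<close>. Hence the function \<open>F(a, b) = b q(b/a)\<close>, which is homogeneous of
  degree one, takes its values in the cone spanned by \<open>a\<close> and \<open>b\<close>, and so maps the square of the
  right half-plane to the closed right half-plane. Conjugating \<open>F\<close> by the Cayley transform
  \<open>z \<mapsto> (1 - z)/(1 + z)\<close>, which is tangent to \<open>z \<mapsto> (1 - z)/2\<close> at \<open>1\<close>, gives the
  function \<open>\<phi>\<close>; its derivative at \<open>(1, 1)\<close> in direction \<open>-\<delta>\<close> is \<open>-F(\<delta>)\<close> by homogeneity.\<close>

section \<open>Extension across the positive half-line\<close>

lemma open_upper_half_plane: "open upper_half_plane"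
  unfolding upper_half_plane_def by (rule open_halfspace_Im_gt)

lemma convex_upper_half_plane: "convex upper_half_plane"
  unfolding upper_half_plane_def by (rule convex_halfspace_Im_gt)

text \<open>By the open mapping theorem a nonconstant \<open>h\<close> has open image, and an open
  subset of the closed half-plane avoids the real axis. Strict positivity is what the Schwarz-Pick
  estimate and the logarithm below require.\<close>

lemma pick_class_constant_or_pos:
  assumes "h \<in> pick_class"
  shows "(\<exists>c. \<forall>z\<in>upper_half_plane. h z = c) \<or> (\<forall>z\<in>upper_half_plane. Im (h z) > 0)"
proof (cases "h constant_on upper_half_plane")
  case True
  then show ?thesis by (auto simp: constant_on_def)
next
  case False
  have "open (h ` upper_half_plane)"
    using open_mapping_thm[of h upper_half_plane upper_half_plane] False assms
      open_upper_half_plane convex_connected[OF convex_upper_half_plane]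
    by (auto simp: pick_class_def)
  moreover have "h ` upper_half_plane \<subseteq> {w. Im w \<ge> 0}"
    using assms by (auto simp: pick_class_def)
  ultimately have "h ` upper_half_plane \<subseteq> interior {w. Im w \<ge> 0}"
    by (simp add: interior_maximal)
  also have "interior {w. Im w \<ge> 0} = {w. Im w > 0}"
    using interior_halfspace_ge[of \<i> 0] by (simp add: inner_complex_def)
  finally show ?thesis by auto
qed

text \<open>The squared distances differ by \<open>4 * Im u * Im c\<close>. Hence the Moebius map
  \<open>(u - c) / (u - cnj c)\<close> sends the upper half-plane into the unit disc.\<close>

lemma norm_diff_less_norm_diff_cnj:
  assumes "Im u > 0" "Im c > 0"
  shows "norm (u - c) < norm (u - cnj c)"
proof -
  have "Im u * Im c > 0" using assms by simp
  then have "(norm (u - c))\<^sup>2 < (norm (u - cnj c))\<^sup>2"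
    unfolding cmod_power2 by (simp add: power2_eq_square algebra_simps)
  then show ?thesis by (rule power2_less_imp_less) simp
qed

text \<open>A Schwarz-Pick estimate: restrict \<open>h\<close> to the disc of radius
  \<open>Im z\<close> about \<open>z\<close>, send \<open>h z\<close> to 0 by a Moebius map, and
  apply the Schwarz lemma. Using this disc instead of the whole half-plane costs a factor 2.\<close>

lemma norm_deriv_le_half_plane:
  assumes hol: "h holomorphic_on upper_half_plane"
    and pos: "\<And>z. z \<in> upper_half_plane \<Longrightarrow> Im (h z) > 0"
    and z: "z \<in> upper_half_plane"
  shows "norm (deriv h z) \<le> 2 * Im (h z) / Im z"
proof -
  define y where "y = Im z"
  have y: "y > 0" using z by (simp add: y_def upper_half_plane_def)
  have mem: "z + of_real y * \<zeta> \<in> upper_half_plane" if "norm \<zeta> < 1" for \<zeta>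
  proof -
    have "- Im \<zeta> < 1" using abs_Im_le_cmod[of \<zeta>] that by linarith
    then have "y * (- Im \<zeta>) < y * 1" using y by (intro mult_strict_left_mono)
    then show ?thesis by (simp add: upper_half_plane_def y_def)
  qed
  define w where "w \<zeta> = (h (z + of_real y * \<zeta>) - h z) / (h (z + of_real y * \<zeta>) - cnj (h z))" for \<zeta>
  have lt: "norm (h (z + of_real y * \<zeta>) - h z) < norm (h (z + of_real y * \<zeta>) - cnj (h z))"
    if "norm \<zeta> < 1" for \<zeta>
    using that mem pos z by (intro norm_diff_less_norm_diff_cnj) auto
  have nz: "h (z + of_real y * \<zeta>) - cnj (h z) \<noteq> 0" if "norm \<zeta> < 1" for \<zeta>
    using lt[OF that] by (metis norm_not_less_zero norm_zero)
  have "(h \<circ> (\<lambda>\<zeta>. z + of_real y * \<zeta>)) holomorphic_on ball 0 1"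
    by (rule holomorphic_on_compose_gen[OF _ hol]) (auto intro!: holomorphic_intros mem)
  then have "w holomorphic_on ball 0 1"
    unfolding w_def using nz by (auto intro!: holomorphic_intros simp: o_def)
  moreover have "norm (w \<zeta>) < 1" if "norm \<zeta> < 1" for \<zeta>
    using lt[OF that] nz[OF that] by (simp add: w_def norm_divide)
  moreover have "w 0 = 0" by (simp add: w_def)
  ultimately have le1: "norm (deriv w 0) \<le> 1"
    using Schwarz_Lemma(2)[of w 0] by simp
  have "(h has_field_derivative deriv h z) (at (z + of_real y * 0))"
    using holomorphic_derivI[OF hol open_upper_half_plane z] by simp
  then have "((\<lambda>\<zeta>. h (z + of_real y * \<zeta>)) has_field_derivative deriv h z * of_real y) (at 0)"
    by (rule DERIV_chain2) (auto intro!: derivative_eq_intros)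
  then have "(w has_field_derivative deriv h z * of_real y / (h z - cnj (h z))) (at 0)"
    unfolding w_def using nz[of 0]
    by (auto intro!: derivative_eq_intros)
  then have "deriv w 0 = deriv h z * of_real y / (h z - cnj (h z))"
    by (rule DERIV_imp_deriv)
  moreover have "norm (h z - cnj (h z)) = 2 * Im (h z)"
    using pos[OF z] by (simp add: complex_diff_cnj norm_mult)
  ultimately have "norm (deriv h z) * y / (2 * Im (h z)) \<le> 1"
    using le1 y by (simp add: norm_mult norm_divide)
  then show ?thesis
    using y pos[OF z] by (simp add: y_def field_simps)
qed

lemma islimpt_upper_half_plane:
  assumes "Im z \<ge> 0"
  shows "z islimpt upper_half_plane"
  unfolding islimpt_approachable
proof (intro allI impI)
  fix e :: real assume "e > 0"
  then show "\<exists>x'\<in>upper_half_plane. x' \<noteq> z \<and> dist x' z < e"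
    using assms
    by (intro bexI[of _ "z + \<i> * of_real (e/2)"])
       (auto simp: dist_norm upper_half_plane_def norm_mult)
qed

text \<open>Extension by uniform continuity yields a function on the closure of the open quadrant;
  this places the boundary half-line in its domain.\<close>

lemma closed_quadrant_subset_closure:
  "{z. a \<le> Re z \<and> 0 \<le> Im z} \<subseteq> closure {z. a < Re z \<and> 0 < Im z}"
proof
  fix z :: complex assume z: "z \<in> {z. a \<le> Re z \<and> 0 \<le> Im z}"
  show "z \<in> closure {z. a < Re z \<and> 0 < Im z}"
    unfolding closure_approachable
  proof (intro allI impI)
    fix e :: real assume e: "e > 0"
    have "norm (Complex (e/3) (e/3)) < e"
      using cmod_le[of "Complex (e/3) (e/3)"] e by simp
    then show "\<exists>y\<in>{z. a < Re z \<and> 0 < Im z}. dist y z < e"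
      using z e by (intro bexI[of _ "z + Complex (e/3) (e/3)"]) (auto simp: dist_norm)
  qed
qed

lemma pick_pair_Im_le:
  assumes "h \<in> pick_class" "(\<lambda>z. - z * h z) \<in> pick_class" "Im z > 0"
  shows "Im (h z) \<ge> 0" "Re z * Im (h z) + Im z * Re (h z) \<le> 0"
  using assms by (auto simp: pick_class_def upper_half_plane_def minus_le_iff algebra_simps)

text \<open>Bounding the derivative of the logarithm of \<open>-h\<close>, rather than of \<open>h\<close>, gives
  uniform continuity without an a priori bound on \<open>h\<close> near the positive half-line.\<close>

lemma pick_pair_continuous_extension:
  assumes h: "h \<in> pick_class" "(\<lambda>z. - z * h z) \<in> pick_class"
    and pos: "\<And>z. z \<in> upper_half_plane \<Longrightarrow> Im (h z) > 0"
    and a: "a > 0"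
  shows "\<exists>E. continuous_on {z. a \<le> Re z \<and> 0 \<le> Im z} E \<and>
             (\<forall>z. a < Re z \<longrightarrow> 0 < Im z \<longrightarrow> E z = h z)"
proof -
  define Q where "Q = {z. a < Re z \<and> 0 < Im z}"
  have hol: "h holomorphic_on upper_half_plane" using h by (simp add: pick_class_def)
  define L where "L z = Ln (- h z)" for z
  have QU: "z \<in> upper_half_plane" if "z \<in> Q" for z
    using that by (simp add: Q_def upper_half_plane_def)
  have der: "(L has_field_derivative deriv h z / h z) (at z within Q)" if z: "z \<in> Q" for z
  proof -
    have "- h z \<notin> \<real>\<^sub>\<le>\<^sub>0" using pos[OF QU[OF z]] by (auto simp: complex_nonpos_Reals_iff)
    moreover have "(h has_field_derivative deriv h z) (at z within Q)"
      using holomorphic_derivI[OF hol open_upper_half_plane QU[OF z]] by simp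
    ultimately show ?thesis
      unfolding L_def by (auto intro!: derivative_eq_intros simp: field_simps)
  qed
  have bd: "norm (deriv h z / h z) \<le> 2 / a" if z: "z \<in> Q" for z
  proof -
    have xy: "Re z > a" "Im z > 0" using z by (auto simp: Q_def)
    have p: "Im (h z) > 0" by (rule pos[OF QU[OF z]])
    \<comment> \<open>The second Pick condition bounds \<open>Im (h z) / Im z\<close> by
      \<open>norm (h z) / Re z\<close>. With Schwarz-Pick this bounds \<open>h'/h\<close> up to the
      positive half-line.\<close>
    have "Re z * Im (h z) \<le> Im z * (- Re (h z))"
      using pick_pair_Im_le(2)[OF h xy(2)] by simp
    also have "\<dots> \<le> Im z * norm (h z)"
      using xy abs_Re_le_cmod[of "h z"] by (intro mult_left_mono) auto
    finally have "Re z * Im (h z) \<le> Im z * norm (h z)" .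
    moreover have "a * Im (h z) \<le> Re z * Im (h z)"
      using xy p by (intro mult_right_mono) auto
    ultimately have "Im (h z) / Im z \<le> norm (h z) / a"
      using xy a by (simp add: field_simps)
    moreover have "norm (deriv h z) \<le> 2 * (Im (h z) / Im z)"
      using norm_deriv_le_half_plane[OF hol pos QU[OF z]] by simp
    ultimately have "norm (deriv h z) \<le> 2 * (norm (h z) / a)" by linarith
    moreover have "norm (h z) > 0" using p by auto
    ultimately show ?thesis using a by (simp add: norm_divide field_simps)
  qed
  have "convex Q"
    unfolding Q_def Collect_conj_eq
    by (intro convex_Int convex_halfspace_Re_gt convex_halfspace_Im_gt)
  then have "norm (L x - L y) \<le> 2 / a * norm (x - y)" if "x \<in> Q" "y \<in> Q" for x y
    using field_differentiable_bound[of Q L "\<lambda>z. deriv h z / h z" "2/a" x y] der bd that by auto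
  then have "(2/a)-lipschitz_on Q L"
    using a by (intro lipschitz_onI) (auto simp: dist_norm)
  then have "uniformly_continuous_on Q L"
    by (rule lipschitz_on_uniformly_continuous)
  then obtain M where M: "uniformly_continuous_on (closure Q) M" "\<And>x. x \<in> Q \<Longrightarrow> L x = M x"
    by (rule uniformly_continuous_on_extension_on_closure) blast
  have "continuous_on {z. a \<le> Re z \<and> 0 \<le> Im z} (\<lambda>z. - exp (M z))"
    using uniformly_continuous_imp_continuous[OF M(1)] closed_quadrant_subset_closure[of a]
    by (auto intro!: continuous_intros elim: continuous_on_subset simp: Q_def)
  moreover have "- exp (M z) = h z" if "a < Re z" "0 < Im z" for z
  proof -
    have z: "z \<in> Q" using that by (simp add: Q_def)
    have "h z \<noteq> 0" using pos[OF QU[OF z]] by auto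
    then show ?thesis using M(2)[OF z] by (simp add: L_def flip: M(2)[OF z])
  qed
  ultimately show ?thesis by blast
qed

text \<open>Continuous boundary values on the positive half-line are real by the two Pick
  inequalities, so Schwarz reflection applies. The conjugation symmetry is recorded because it later
  transfers estimates to the lower half-plane.\<close>

lemma pick_pair_extension_nonconstant:
  assumes h: "h \<in> pick_class" "(\<lambda>z. - z * h z) \<in> pick_class"
    and pos: "\<And>z. z \<in> upper_half_plane \<Longrightarrow> Im (h z) > 0"
  shows "\<exists>g. slit_plane_extension h g \<and> (\<forall>z\<in>- \<real>\<^sub>\<le>\<^sub>0. g (cnj z) = cnj (g z))"
proof -
  let ?U = upper_half_plane
  have hol: "h holomorphic_on ?U" using h by (simp add: pick_class_def)
  obtain E where Ec: "\<And>a. a > 0 \<Longrightarrow> continuous_on {z. a \<le> Re z \<and> 0 \<le> Im z} (E a)"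
    and Eh: "\<And>a z. a > 0 \<Longrightarrow> a < Re z \<Longrightarrow> 0 < Im z \<Longrightarrow> E a z = h z"
    using pick_pair_continuous_extension[OF h pos] by metis
  \<comment> \<open>Taking limits from the upper half-plane makes the boundary value independent of
    \<open>a\<close>, so the extensions \<open>E a\<close> glue together.\<close>
  define f where "f z = Lim (at z within ?U) h" for z
  have nb: "at z within ?U \<noteq> bot" if "Im z \<ge> 0" for z
    using islimpt_upper_half_plane[OF that] by (simp add: trivial_limit_within)
  have fh: "f z = h z" if "z \<in> ?U" for z
  proof -
    have "continuous_on ?U h" using hol by (rule holomorphic_on_imp_continuous_on)
    then have "(h \<longlongrightarrow> h z) (at z within ?U)" using that by (simp add: continuous_on_def)
    then show ?thesis unfolding f_def
      using that by (intro tendsto_Lim nb) (auto simp: upper_half_plane_def)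
  qed
  have lim: "(h \<longlongrightarrow> E a z) (at z within ?U)" if "a > 0" "a < Re z" "0 \<le> Im z" for a z
  proof -
    have "(E a \<longlongrightarrow> E a z) (at z within {z. a \<le> Re z \<and> 0 \<le> Im z})"
      using Ec[OF that(1)] that by (simp add: continuous_on_def)
    then have "(E a \<longlongrightarrow> E a z) (at z within {z. a < Re z \<and> 0 < Im z})"
      by (rule tendsto_within_subset) auto
    then have "(h \<longlongrightarrow> E a z) (at z within {z. a < Re z \<and> 0 < Im z})"
      by (rule Lim_transform_eventually) (auto simp: eventually_at_filter Eh[OF that(1)])
    \<comment> \<open>The two sets agree on the neighbourhood \<open>Re z > a\<close> of the
      point.\<close>
    moreover have "at z within {z. a < Re z \<and> 0 < Im z} = at z within ?U"
      using that by (intro at_within_nhd[of z "{z. Re z > a}"])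
        (auto simp: upper_half_plane_def open_halfspace_Re_gt)
    ultimately show ?thesis by simp
  qed
  have fE: "f z = E a z" if "a > 0" "a < Re z" "0 \<le> Im z" for a z
    unfolding f_def using lim[OF that] that by (intro tendsto_Lim nb)
  let ?S = "- \<real>\<^sub>\<le>\<^sub>0 :: complex set"
  have Spos: "Re z > 0" if "z \<in> ?S" "Im z = 0" for z
    using that by (auto simp: complex_nonpos_Reals_iff)
  have cont: "continuous_on (?S \<inter> {z. 0 \<le> Im z}) f"
    unfolding continuous_on_def
  proof
    fix z assume z: "z \<in> ?S \<inter> {z. 0 \<le> Im z}"
    show "(f \<longlongrightarrow> f z) (at z within ?S \<inter> {z. 0 \<le> Im z})"
    proof (cases "Im z > 0")
      case True
      then have zU: "z \<in> ?U" by (simp add: upper_half_plane_def)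
      have "(h \<longlongrightarrow> h z) (at z)"
        using holomorphic_on_imp_continuous_on[OF hol] zU open_upper_half_plane
        by (simp add: continuous_on_eq_continuous_at isCont_def)
      moreover have "eventually (\<lambda>w. h w = f w) (at z)"
        using eventually_at_in_open'[OF open_upper_half_plane zU]
        by (rule eventually_mono) (simp add: fh)
      ultimately have "(f \<longlongrightarrow> h z) (at z)"
        by (rule Lim_transform_eventually)
      then show ?thesis unfolding fh[OF zU] by (rule Lim_at_imp_Lim_at_within)
    next
      case False
      define a where "a = Re z / 2"
      have a: "a > 0" "a < Re z" "0 \<le> Im z" using Spos[of z] z False by (auto simp: a_def)
      have "(E a \<longlongrightarrow> E a z) (at z within {z. a \<le> Re z \<and> 0 \<le> Im z})"
        using Ec[OF a(1)] a by (simp add: continuous_on_def)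
      then have "(E a \<longlongrightarrow> E a z) (at z within {z. a < Re z \<and> 0 \<le> Im z})"
        by (rule tendsto_within_subset) auto
      then have "(f \<longlongrightarrow> E a z) (at z within {z. a < Re z \<and> 0 \<le> Im z})"
        by (rule Lim_transform_eventually) (auto simp: eventually_at_filter fE[OF a(1)])
      moreover have "at z within {z. a < Re z \<and> 0 \<le> Im z} = at z within ?S \<inter> {z. 0 \<le> Im z}"
        using a by (intro at_within_nhd[of z "{z. Re z > a}"])
          (auto simp: open_halfspace_Re_gt complex_nonpos_Reals_iff)
      ultimately show ?thesis by (simp add: fE[OF a])
    qed
  qed
  have real: "f z \<in> \<real>" if z: "z \<in> ?S" "z \<in> \<real>" for z
  proof -
    have Im0: "Im z = 0" using z by (simp add: complex_is_Real_iff)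
    then have x: "Re z > 0" using Spos z by simp
    have lf: "(h \<longlongrightarrow> f z) (at z within ?U)"
      using lim[of "Re z / 2" z] fE[of "Re z / 2" z] x Im0 by simp
    \<comment> \<open>At real \<open>z > 0\<close> the limit of the second Pick inequality reads
      \<open>Re z * Im (f z) \<le> 0\<close>, while the first gives
      \<open>Im (f z) \<ge> 0\<close>.\<close>
    have "Re z * Im (f z) + Im z * Re (f z) \<le> 0"
    proof (rule tendsto_upperbound)
      show "((\<lambda>w. Re w * Im (h w) + Im w * Re (h w)) \<longlongrightarrow> Re z * Im (f z) + Im z * Re (f z)) (at z within ?U)"
        by (intro tendsto_intros lf)
      show "\<forall>\<^sub>F w in at z within ?U. Re w * Im (h w) + Im w * Re (h w) \<le> 0"
        by (auto simp: eventually_at_filter upper_half_plane_def pick_pair_Im_le[OF h])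
    qed (use nb Im0 in auto)
    then have "Im (f z) \<le> 0" using Im0 x by (simp add: mult_le_0_iff)
    moreover have "0 \<le> Im (f z)"
    proof (rule tendsto_lowerbound)
      show "((\<lambda>w. Im (h w)) \<longlongrightarrow> Im (f z)) (at z within ?U)"
        by (intro tendsto_intros lf)
      show "\<forall>\<^sub>F w in at z within ?U. 0 \<le> Im (h w)"
        by (auto simp: eventually_at_filter upper_half_plane_def pick_pair_Im_le[OF h])
    qed (use nb Im0 in auto)
    ultimately show ?thesis by (simp add: complex_is_Real_iff)
  qed
  define g where "g z = (if 0 \<le> Im z then f z else cnj (f (cnj z)))" for z
  have "g holomorphic_on ?S"
    unfolding g_def
  proof (rule Schwarz_reflection)
    show "open ?S" by (simp add: open_Compl)
    show "cnj ` ?S \<subseteq> ?S" by (auto simp: complex_nonpos_Reals_iff)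
    have "f holomorphic_on ?U" using hol fh by (metis holomorphic_transform)
    then show "f holomorphic_on ?S \<inter> {z. 0 < Im z}"
      by (rule holomorphic_on_subset) (auto simp: upper_half_plane_def)
  qed (use cont real in auto)
  moreover have "g z = h z" if "z \<in> ?U" for z
    using that fh by (simp add: g_def upper_half_plane_def)
  moreover have "g (complex_of_real x) \<in> \<real>" if "x > 0" for x
    using that real[of "of_real x"] by (simp add: g_def)
  moreover have "g (cnj z) = cnj (g z)" if "z \<in> ?S" for z
  proof (cases "Im z = 0")
    case True
    then have "z \<in> \<real>" by (simp add: complex_is_Real_iff)
    with real[OF that] have "cnj z = z" "cnj (f z) = f z" by (simp_all add: Reals_cnj_iff)
    then show ?thesis using True by (simp add: g_def)
  qed (simp add: g_def)
  ultimately show ?thesis unfolding slit_plane_extension_def by blast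
qed

text \<open>By the dichotomy only constant \<open>h\<close> remains. The Pick conditions force the
  constant to be real, and it is then its own extension.\<close>

lemma pick_pair_extension:
  assumes h: "h \<in> pick_class" "(\<lambda>z. - z * h z) \<in> pick_class"
  shows "\<exists>g. slit_plane_extension h g \<and> (\<forall>z\<in>- \<real>\<^sub>\<le>\<^sub>0. g (cnj z) = cnj (g z))"
  using pick_class_constant_or_pos[OF h(1)]
proof
  assume "\<exists>c. \<forall>z\<in>upper_half_plane. h z = c"
  then obtain c where c: "\<And>z. Im z > 0 \<Longrightarrow> h z = c" by (auto simp: upper_half_plane_def)
  have ge: "Im c \<ge> 0"
    using pick_pair_Im_le(1)[OF h, of \<i>] c by simp
  \<comment> \<open>The height 1 is fixed and the real part is free; an affine function of
    \<open>x\<close> bounded above on the whole line has slope 0.\<close>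
  have le: "x * Im c + Re c \<le> 0" for x
    using pick_pair_Im_le(2)[OF h, of "Complex x 1"] c by simp
  have "Im c = 0"
  proof (rule ccontr)
    assume "Im c \<noteq> 0"
    then show False using le[of "(1 - Re c) / Im c"] by simp
  qed
  then have "c \<in> \<real>" by (simp add: complex_is_Real_iff)
  then have "slit_plane_extension h (\<lambda>_. c)" "cnj c = c"
    using c by (auto simp: slit_plane_extension_def upper_half_plane_def Reals_cnj_iff)
  then show ?thesis by (intro exI[of _ "\<lambda>_. c"]) auto
qed (use pick_pair_extension_nonconstant[OF h] in blast)

section \<open>The homogeneous function of two variables\<close>

lemma inward_directions_one:
  "inward_directions (1, 1) = {\<delta>. Re (fst \<delta>) > 0 \<and> Re (snd \<delta>) > 0}"
  by (simp add: inward_directions_def)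

text \<open>A quotient \<open>r \<le> 0\<close> would give
  \<open>Re b = r * Re a \<le> 0\<close>.\<close>

lemma quotient_in_slit_plane:
  assumes "Re a > 0" "Re b > 0"
  shows "b / a \<in> - \<real>\<^sub>\<le>\<^sub>0"
proof
  assume "b / a \<in> \<real>\<^sub>\<le>\<^sub>0"
  then obtain r where r: "b / a = of_real r" "r \<le> 0" by (auto elim: nonpos_Reals_cases)
  have "a \<noteq> 0" using assms by auto
  then have "b = of_real r * a" using r(1) by (simp add: field_simps)
  then have "Re b = r * Re a" by simp
  then show False using assms r(2) by (simp add: mult_le_0_iff zero_less_mult_iff)
qed

text \<open>This is the function \<open>F\<close> of the overview, with the extension
  \<open>g\<close> in place of \<open>h\<close>.\<close>

definition hom_ext :: "(complex \<Rightarrow> complex) \<Rightarrow> complex \<times> complex \<Rightarrow> complex" where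
  "hom_ext g p = - (snd p * g (snd p / fst p))"

lemma hom_ext_scaleR: "hom_ext g (s *\<^sub>R p) = of_real s * hom_ext g p"
  by (cases "s = 0") (simp_all add: hom_ext_def scaleR_conv_of_real)

lemma continuous_on_hom_ext:
  assumes "g holomorphic_on (- \<real>\<^sub>\<le>\<^sub>0)"
  shows "continuous_on (inward_directions (1, 1)) (hom_ext g)"
proof -
  have "continuous_on (inward_directions (1, 1)) (\<lambda>p. g (snd p / fst p))"
  proof (rule continuous_on_compose2[OF holomorphic_on_imp_continuous_on[OF assms]])
    show "continuous_on (inward_directions (1, 1)) (\<lambda>p. snd p / fst p)"
      by (intro continuous_intros) (auto simp: inward_directions_one)
    show "(\<lambda>p. snd p / fst p) ` inward_directions (1, 1) \<subseteq> - \<real>\<^sub>\<le>\<^sub>0"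
      using quotient_in_slit_plane unfolding inward_directions_one by blast
  qed
  then show ?thesis unfolding hom_ext_def by (intro continuous_intros)
qed

lemma open_inward_directions_one: "open (inward_directions (1, 1))"
  unfolding inward_directions_one Collect_conj_eq
  by (intro open_Int open_Collect_less continuous_intros)

lemma hom_ext_Re_nonneg_upper:
  assumes h: "h \<in> pick_class" "(\<lambda>z. - z * h z) \<in> pick_class"
    and g: "slit_plane_extension h g"
    and a: "Re a > 0" and b: "Re b > 0" and y: "Im (b / a) > 0"
  shows "Re (hom_ext g (a, b)) \<ge> 0"
proof -
  define z where "z = b / a"
  define q where "q = - h z"
  have "a \<noteq> 0" using a by auto
  then have bz: "b = z * a" by (simp add: z_def)
  have y: "Im z > 0" using y by (simp add: z_def)
  have gz: "g z = h z" using g y by (simp add: slit_plane_extension_def upper_half_plane_def)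
  have s1: "Im (z * q) \<ge> 0" and s2: "- Im q \<ge> 0"
    using pick_pair_Im_le[OF h y] by (simp_all add: q_def)
  \<comment> \<open>The cone decomposition: up to positive factors, \<open>q\<close> is a
    combination of 1 and \<open>1/z\<close>, whose coefficients \<open>Im (z * q)\<close> and
    \<open>- Im q\<close> are nonnegative by the two Pick conditions. Multiplying by
    \<open>b = z * a\<close> turns it into a combination of \<open>b\<close> and
    \<open>a\<close>.\<close>
  have "of_real (Im z) * q = of_real (Im (z * q)) - of_real (Im q) * cnj z"
    by (simp add: complex_eq_iff algebra_simps)
  then have "of_real (Im z) * q * b = (of_real (Im (z * q)) - of_real (Im q) * cnj z) * (z * a)"
    by (simp add: bz)
  also have "\<dots> = of_real (Im (z * q)) * b + of_real (- Im q) * (z * cnj z) * a"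
    by (simp add: bz algebra_simps)
  also have "z * cnj z = of_real ((norm z)\<^sup>2)"
    by (rule complex_norm_square[symmetric])
  finally have "of_real (Im z) * hom_ext g (a, b) =
      of_real (Im (z * q)) * b + of_real (- Im q * (norm z)\<^sup>2) * a"
    by (simp add: hom_ext_def gz q_def mult_ac flip: z_def)
  then have "Re (of_real (Im z) * hom_ext g (a, b)) =
      Re (of_real (Im (z * q)) * b + of_real (- Im q * (norm z)\<^sup>2) * a)"
    by (rule arg_cong)
  then have "Im z * Re (hom_ext g (a, b)) = Im (z * q) * Re b + (- Im q * (norm z)\<^sup>2) * Re a"
    by (simp only: Re_complex_of_real Im_complex_of_real times_complex.sel plus_complex.sel
        mult_zero_left diff_zero)
  moreover have "Im (z * q) * Re b \<ge> 0" using s1 b by (intro mult_nonneg_nonneg) auto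
  moreover have "(- Im q * (norm z)\<^sup>2) * Re a \<ge> 0"
    using s2 a by (intro mult_nonneg_nonneg) auto
  ultimately have "Im z * Re (hom_ext g (a, b)) \<ge> 0" by linarith
  then show ?thesis using y by (simp add: zero_le_mult_iff)
qed

text \<open>The sign of \<open>Im (b / a)\<close> decides: the upper case is known, the lower one
  follows by conjugation, and the real one by continuity.\<close>

lemma hom_ext_Re_nonneg:
  assumes h: "h \<in> pick_class" "(\<lambda>z. - z * h z) \<in> pick_class"
    and g: "slit_plane_extension h g"
    and sym: "\<And>z. z \<in> - \<real>\<^sub>\<le>\<^sub>0 \<Longrightarrow> g (cnj z) = cnj (g z)"
    and p: "p \<in> inward_directions (1, 1)"
  shows "Re (hom_ext g p) \<ge> 0"
proof -
  obtain a b where ab: "p = (a, b)" "Re a > 0" "Re b > 0"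
    using p by (cases p) (auto simp: inward_directions_one)
  consider "Im (b / a) > 0" | "Im (b / a) < 0" | "Im (b / a) = 0" by linarith
  then show ?thesis
  proof cases
    case 1
    then show ?thesis using hom_ext_Re_nonneg_upper[OF h g] ab by simp
  next
    case 2
    have "Im (cnj b / cnj a) > 0" using 2 by (simp flip: complex_cnj_divide)
    then have "Re (hom_ext g (cnj a, cnj b)) \<ge> 0"
      using hom_ext_Re_nonneg_upper[OF h g, of "cnj a" "cnj b"] ab by simp
    moreover have "hom_ext g (cnj a, cnj b) = cnj (hom_ext g (a, b))"
      using sym[OF quotient_in_slit_plane[OF ab(2,3)]] by (simp add: hom_ext_def)
    ultimately show ?thesis using ab by simp
  next
    case 3
    \<comment> \<open>Chosen so that \<open>b' t / a = b / a + \<i> * t\<close>, which lies in the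
      upper half-plane for \<open>t > 0\<close>.\<close>
    define b' where "b' t = b + \<i> * of_real t * a" for t :: real
    have "a \<noteq> 0" using ab by auto
    have Im: "Im (b' t / a) = t" for t
      using 3 \<open>a \<noteq> 0\<close> by (simp add: b'_def add_divide_distrib)
    have "((\<lambda>t. (a, b' t)) \<longlongrightarrow> (a, b' 0)) (at_right 0)"
      unfolding b'_def by (intro tendsto_intros)
    then have lim: "((\<lambda>t. (a, b' t)) \<longlongrightarrow> p) (at_right 0)" by (simp add: b'_def ab)
    have "isCont (hom_ext g) p"
      using continuous_on_hom_ext[of g] g p open_inward_directions_one
      by (simp add: continuous_on_eq_continuous_at slit_plane_extension_def)
    then have "((\<lambda>t. Re (hom_ext g (a, b' t))) \<longlongrightarrow> Re (hom_ext g p)) (at_right 0)"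
      by (intro tendsto_Re isCont_tendsto_compose[OF _ lim])
    moreover have "\<forall>\<^sub>F t in at_right 0. 0 \<le> Re (hom_ext g (a, b' t))"
    proof -
      have "\<forall>\<^sub>F t in at_right 0. (a, b' t) \<in> inward_directions (1, 1)"
        using topological_tendstoD[OF lim open_inward_directions_one p] .
      moreover have "\<forall>\<^sub>F t in at_right (0::real). t > 0" by (rule eventually_at_right_less)
      ultimately show ?thesis
        by eventually_elim
          (rule hom_ext_Re_nonneg_upper[OF h g], auto simp: inward_directions_one Im)
    qed
    ultimately show ?thesis by (rule tendsto_lowerbound) simp
  qed
qed

text \<open>After scaling to \<open>norm a = 1\<close>, the pairs satisfying the three inequalities form a subset
  of a compact set on which \<open>hom_ext g\<close> is continuous.\<close>

lemma hom_ext_linear_bound: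
  assumes g: "g holomorphic_on (- \<real>\<^sub>\<le>\<^sub>0)" and N: "N > 0"
  shows "\<exists>M. \<forall>a b. a \<noteq> 0 \<longrightarrow> norm a \<le> N * Re a \<longrightarrow> norm a \<le> N * Re b \<longrightarrow> norm b \<le> N * Re a \<longrightarrow>
    norm (hom_ext g (a, b)) \<le> M * norm a"
proof -
  \<comment> \<open>Dividing the first two inequalities by \<open>N * norm a\<close> gives the lower
    bounds \<open>1/N\<close>; the third gives \<open>norm b \<le> N * norm a\<close>, since
    \<open>Re a \<le> norm a\<close>.\<close>
  define T :: "(complex \<times> complex) set" where
    "T = (cball 0 1 \<inter> {z. Re z \<ge> 1/N}) \<times> (cball 0 N \<inter> {z. Re z \<ge> 1/N})"
  have "compact T"
    unfolding T_def
    by (intro compact_Times compact_Int_closed compact_cball closed_halfspace_Re_ge)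
  moreover have "T \<subseteq> inward_directions (1, 1)"
    using N by (auto simp: T_def inward_directions_one intro: less_le_trans[of 0 "1/N"])
  ultimately have "compact (hom_ext g ` T)"
    using continuous_on_subset[OF continuous_on_hom_ext[OF g]] compact_continuous_image by blast
  then obtain M where M: "\<And>p. p \<in> T \<Longrightarrow> norm (hom_ext g p) \<le> M"
    using compact_imp_bounded bounded_iff by (metis imageI)
  have "norm (hom_ext g (a, b)) \<le> M * norm a"
    if "a \<noteq> 0" and 1: "norm a \<le> N * Re a" and 2: "norm a \<le> N * Re b" and 3: "norm b \<le> N * Re a"
    for a b
  proof -
    define s where "s = norm a"
    have s: "s > 0" using that by (simp add: s_def)
    have "norm b \<le> N * s"
      using 3 complex_Re_le_cmod[of a] N unfolding s_def
      by (meson less_imp_le mult_left_mono order_trans)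
    then have "(1/s) *\<^sub>R (a, b) \<in> T"
      using 1 2 s N by (auto simp: T_def field_simps simp flip: s_def)
    then have "norm (hom_ext g ((1/s) *\<^sub>R (a, b))) \<le> M" by (rule M)
    then show ?thesis
      using s unfolding hom_ext_scaleR norm_mult by (simp add: norm_divide field_simps flip: s_def)
  qed
  then show ?thesis by blast
qed

section \<open>Transfer to the bidisc\<close>

text \<open>Away from -1 this map is its own inverse, exchanging the disc and the right half-plane,
  so it serves both for the two arguments and for the value.\<close>

definition cayley :: "complex \<Rightarrow> complex" where
  "cayley z = (1 - z) / (1 + z)"

lemma Re_cayley: "Re (cayley z) = (1 - (norm z)\<^sup>2) / (norm (1 + z))\<^sup>2"
proof -
  have "cayley z = (1 - z) * cnj (1 + z) / of_real ((norm (1 + z))\<^sup>2)"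
    unfolding cayley_def by (subst complex_div_cnj) simp
  then have "Re (cayley z) = Re ((1 - z) * cnj (1 + z)) / (norm (1 + z))\<^sup>2"
    by (simp only: Re_divide_of_real)
  moreover have "Re ((1 - z) * cnj (1 + z)) = 1 - (norm z)\<^sup>2"
    unfolding cmod_power2 by (simp add: power2_eq_square algebra_simps)
  ultimately show ?thesis by (simp only:)
qed

lemma one_plus_nonzero: "norm z < 1 \<Longrightarrow> 1 + z \<noteq> (0::complex)"
  by (metis add.commute add_eq_0_iff norm_minus_cancel norm_one order_less_irrefl)

lemma Re_cayley_pos:
  assumes "norm z < 1"
  shows "Re (cayley z) > 0"
  unfolding Re_cayley using one_plus_nonzero[OF assms] assms
  by (simp add: power_less_one_iff abs_square_less_1)

lemma norm_cayley_le_one: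
  assumes "Re z \<ge> 0"
  shows "norm (cayley z) \<le> 1"
proof -
  have "(norm (1 - z))\<^sup>2 \<le> (norm (1 + z))\<^sup>2"
    unfolding cmod_power2 using assms by (simp add: power2_eq_square algebra_simps)
  then have "norm (1 - z) \<le> norm (1 + z)" by (rule power2_le_imp_le) simp
  then show ?thesis by (cases "1 + z = 0") (simp_all add: cayley_def norm_divide)
qed

lemma holomorphic_on_cayley: "cayley holomorphic_on (- {- 1})"
  unfolding cayley_def by (intro holomorphic_intros) (auto simp: add_eq_0_iff)

section \<open>Closure rules for analyticity in two variables\<close>

lemma analytic2_on_fst: "analytic2_on fst S"
  unfolding analytic2_on_def
proof
  fix p :: "complex \<times> complex"
  have "(fst has_derivative (\<lambda>v. 1 * fst v + 0 * snd v)) (at p)"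
    using bounded_linear_imp_has_derivative[OF bounded_linear_fst] by simp
  then show "\<exists>a b. (fst has_derivative (\<lambda>v. a * fst v + b * snd v)) (at p)"
    by blast
qed

lemma analytic2_on_snd: "analytic2_on snd S"
  unfolding analytic2_on_def
proof
  fix p :: "complex \<times> complex"
  have "(snd has_derivative (\<lambda>v. 0 * fst v + 1 * snd v)) (at p)"
    using bounded_linear_imp_has_derivative[OF bounded_linear_snd] by simp
  then show "\<exists>a b. (snd has_derivative (\<lambda>v. a * fst v + b * snd v)) (at p)"
    by blast
qed

lemma analytic2_on_mult:
  assumes "analytic2_on f S" "analytic2_on g S"
  shows "analytic2_on (\<lambda>p. f p * g p) S"
  unfolding analytic2_on_def
proof
  fix p assume p: "p \<in> S"
  obtain a b where f: "(f has_derivative (\<lambda>v. a * fst v + b * snd v)) (at p)"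
    using assms(1) p unfolding analytic2_on_def by blast
  obtain c d where g: "(g has_derivative (\<lambda>v. c * fst v + d * snd v)) (at p)"
    using assms(2) p unfolding analytic2_on_def by blast
  have "((\<lambda>p. f p * g p) has_derivative
      (\<lambda>v. (f p * c + a * g p) * fst v + (f p * d + b * g p) * snd v)) (at p)"
    by (rule has_derivative_eq_rhs[OF has_derivative_mult[OF f g]]) (auto simp: algebra_simps)
  then show "\<exists>a b. ((\<lambda>p. f p * g p) has_derivative (\<lambda>v. a * fst v + b * snd v)) (at p)"
    by blast
qed

lemma analytic2_on_compose:
  assumes f: "analytic2_on f S" and u: "u holomorphic_on T" "open T" and ST: "f ` S \<subseteq> T"
  shows "analytic2_on (\<lambda>p. u (f p)) S"
  unfolding analytic2_on_def
proof
  fix p assume p: "p \<in> S"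
  obtain a b where f: "(f has_derivative (\<lambda>v. a * fst v + b * snd v)) (at p)"
    using f p unfolding analytic2_on_def by blast
  have "(u has_field_derivative deriv u (f p)) (at (f p))"
    using holomorphic_derivI[OF u] ST p by blast
  from has_derivative_compose[OF f has_field_derivative_imp_has_derivative[OF this]]
  have "((\<lambda>p. u (f p)) has_derivative
      (\<lambda>v. (deriv u (f p) * a) * fst v + (deriv u (f p) * b) * snd v)) (at p)"
    by (rule has_derivative_eq_rhs) (auto simp: algebra_simps)
  then show "\<exists>a b. ((\<lambda>p. u (f p)) has_derivative (\<lambda>v. a * fst v + b * snd v)) (at p)"
    by blast
qed

section \<open>The function on the bidisc and its directional derivatives\<close>

definition model :: "(complex \<Rightarrow> complex) \<Rightarrow> complex \<times> complex \<Rightarrow> complex" where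
  "model g p = cayley (hom_ext g (cayley (fst p), cayley (snd p)))"

lemma cayley_pair_inward:
  "p \<in> bidisc \<Longrightarrow> (cayley (fst p), cayley (snd p)) \<in> inward_directions (1, 1)"
  by (auto simp: bidisc_def inward_directions_one intro: Re_cayley_pos)

lemma model_schur_class2:
  assumes g: "g holomorphic_on (- \<real>\<^sub>\<le>\<^sub>0)"
    and Re: "\<And>p. p \<in> inward_directions (1, 1) \<Longrightarrow> Re (hom_ext g p) \<ge> 0"
  shows "model g \<in> schur_class2"
proof -
  have hol: "cayley holomorphic_on ball 0 1"
    by (rule holomorphic_on_subset[OF holomorphic_on_cayley]) auto
  have nz: "cayley z \<noteq> 0" if "z \<in> ball 0 1" for z
    using Re_cayley_pos[of z] that by auto
  have c2: "analytic2_on (\<lambda>p. cayley (snd p)) bidisc"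
    by (rule analytic2_on_compose[OF analytic2_on_snd hol]) (auto simp: bidisc_def)
  have c1: "analytic2_on (\<lambda>p. inverse (cayley (fst p))) bidisc"
    by (rule analytic2_on_compose[OF analytic2_on_fst, of "\<lambda>z. inverse (cayley z)" "ball 0 1"])
       (auto simp: bidisc_def intro!: holomorphic_intros hol nz)
  have "analytic2_on (\<lambda>p. - g (cayley (snd p) * inverse (cayley (fst p)))) bidisc"
  proof (rule analytic2_on_compose[OF analytic2_on_mult[OF c2 c1], of "\<lambda>z. - g z" "- \<real>\<^sub>\<le>\<^sub>0"])
    show "(\<lambda>p. cayley (snd p) * inverse (cayley (fst p))) ` bidisc \<subseteq> - \<real>\<^sub>\<le>\<^sub>0"
    proof (rule image_subsetI)
      fix p assume "p \<in> bidisc"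
      then show "cayley (snd p) * inverse (cayley (fst p)) \<in> - \<real>\<^sub>\<le>\<^sub>0"
        using quotient_in_slit_plane cayley_pair_inward[of p]
        unfolding divide_inverse inward_directions_one by simp
    qed
  qed (auto intro!: holomorphic_intros g)
  from analytic2_on_mult[OF c2 this]
  have "analytic2_on (\<lambda>p. hom_ext g (cayley (fst p), cayley (snd p))) bidisc"
    by (simp add: hom_ext_def divide_inverse)
  then have "analytic2_on (model g) bidisc"
    unfolding model_def
  proof (rule analytic2_on_compose[OF _ holomorphic_on_cayley])
    \<comment> \<open>The pole -1 of the outer Cayley transform has negative real part.\<close>
    show "(\<lambda>p. hom_ext g (cayley (fst p), cayley (snd p))) ` bidisc \<subseteq> - {- 1}"
      using Re[OF cayley_pair_inward] by force
  qed auto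
  moreover have "model g ` bidisc \<subseteq> cball 0 1"
    using Re[OF cayley_pair_inward] norm_cayley_le_one by (auto simp: model_def)
  ultimately show ?thesis by (simp add: schur_class2_def)
qed

text \<open>Since \<open>cayley (1 - t * a) = t * (a / (2 - t * a))\<close>, homogeneity pulls the
  factor \<open>t\<close> out and the difference quotient becomes
  \<open>- 2 * G t / (1 + t * G t)\<close>. Here \<open>G t\<close> tends to the value of
  \<open>hom_ext g\<close> at half of \<open>\<delta>\<close>, which is half its value at
  \<open>\<delta>\<close>.\<close>

lemma model_has_inward_derivative:
  assumes g: "g holomorphic_on (- \<real>\<^sub>\<le>\<^sub>0)" and d: "\<delta> \<in> inward_directions (1, 1)"
  shows "has_inward_derivative (model g) (1, 1) 1 \<delta> (- hom_ext g \<delta>)"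
proof -
  obtain a b where ab: "\<delta> = (a, b)" by (cases \<delta>)
  define G where "G t = hom_ext g (a / (2 - of_real t * a), b / (2 - of_real t * b))" for t :: real
  have lim: "((\<lambda>t. (a / (2 - of_real t * a), b / (2 - of_real t * b))) \<longlongrightarrow> (a / 2, b / 2)) (at_right 0)"
    by (auto intro!: tendsto_eq_intros)
  have half: "(a / 2, b / 2) = (1/2) *\<^sub>R \<delta>" by (simp add: ab scaleR_conv_of_real)
  have "(1/2) *\<^sub>R \<delta> \<in> inward_directions (1, 1)" using d by (simp add: inward_directions_one)
  then have "isCont (hom_ext g) (a / 2, b / 2)"
    using continuous_on_hom_ext[OF g] open_inward_directions_one
    by (simp add: continuous_on_eq_continuous_at half)
  from isCont_tendsto_compose[OF this lim]
  have G: "(G \<longlongrightarrow> hom_ext g \<delta> / 2) (at_right 0)"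
    unfolding G_def half hom_ext_scaleR by simp
  have tG: "((\<lambda>t. 1 + of_real t * G t) \<longlongrightarrow> 1) (at_right 0)"
    by (rule tendsto_eq_intros G | simp)+
  have "((\<lambda>t. - 2 * G t / (1 + of_real t * G t)) \<longlongrightarrow> - hom_ext g \<delta>) (at_right 0)"
    by (rule tendsto_eq_intros G tG | simp)+
  moreover have "\<forall>\<^sub>F t in at_right 0. - 2 * G t / (1 + of_real t * G t) =
      (model g ((1, 1) - t *\<^sub>R \<delta>) - 1) / of_real t"
  proof -
    have "\<forall>\<^sub>F t in at_right 0. 1 + of_real t * G t \<noteq> 0"
      using tendsto_imp_eventually_ne[OF tG] by simp
    moreover have "\<forall>\<^sub>F t in at_right (0::real). t > 0" by (rule eventually_at_right_less)
    ultimately show ?thesis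
    proof eventually_elim
      case (elim t)
      have "(cayley (fst ((1, 1) - t *\<^sub>R \<delta>)), cayley (snd ((1, 1) - t *\<^sub>R \<delta>))) =
          t *\<^sub>R (a / (2 - of_real t * a), b / (2 - of_real t * b))"
        by (simp add: cayley_def ab scaleR_conv_of_real)
      then have "model g ((1, 1) - t *\<^sub>R \<delta>) = cayley (of_real t * G t)"
        unfolding model_def G_def by (simp only: hom_ext_scaleR)
      then show ?case using elim by (simp add: cayley_def field_simps)
    qed
  qed
  ultimately show ?thesis
    unfolding has_inward_derivative_def by (rule Lim_transform_eventually)
qed

section \<open>The carapoint condition\<close>

text \<open>Along the diagonal radius the denominator \<open>1 - norm_inf\<close> equals
  \<open>t\<close>, and the numerator is at most \<open>norm (\<phi> - 1)\<close>, so the quotient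
  stays below any bound above \<open>norm D\<close> for small \<open>t\<close>.\<close>

lemma has_inward_derivative_imp_carapoint:
  assumes "has_inward_derivative \<phi> (1, 1) 1 (1, 1) D"
  shows "carapoint \<phi> (1, 1)"
proof -
  let ?R = "\<lambda>p. ereal ((1 - norm (\<phi> p)) / (1 - norm_inf p))"
  let ?c = "\<lambda>t::real. (1, 1) - t *\<^sub>R (1, 1) :: complex \<times> complex"
  have "Liminf (at (1, 1) within bidisc) ?R \<noteq> \<infinity>"
  proof
    assume "Liminf (at (1, 1) within bidisc) ?R = \<infinity>"
    then have ev: "\<forall>\<^sub>F p in at (1, 1) within bidisc. ?R p > ereal (norm D + 1)"
      by (intro less_LiminfD) simp
    have small: "\<forall>\<^sub>F t in at_right (0::real). t > 0 \<and> t < 1"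
      unfolding eventually_at_right_field by (intro exI[of _ 1]) auto
    have nrm: "norm (1 - complex_of_real t) = 1 - t" if "t < 1" for t
      using that norm_of_real[of "1 - t", where 'a = complex] by simp
    have "filterlim ?c (at (1, 1) within bidisc) (at_right 0)"
      unfolding filterlim_at
    proof
      show "\<forall>\<^sub>F t in at_right 0. ?c t \<in> bidisc \<and> ?c t \<noteq> (1, 1)"
        using small by eventually_elim (auto simp: bidisc_def scaleR_conv_of_real nrm)
      have "(?c \<longlongrightarrow> (1, 1) - 0 *\<^sub>R (1, 1)) (at_right 0)" by (intro tendsto_intros)
      then show "(?c \<longlongrightarrow> (1, 1)) (at_right 0)" by simp
    qed
    then have A: "\<forall>\<^sub>F t in at_right 0. ?R (?c t) > ereal (norm D + 1)"
      using ev by (rule eventually_compose_filterlim[rotated])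
    have "((\<lambda>t. norm ((\<phi> (?c t) - 1) / of_real t)) \<longlongrightarrow> norm D) (at_right 0)"
      using assms unfolding has_inward_derivative_def by (rule tendsto_norm)
    then have B: "\<forall>\<^sub>F t in at_right 0. norm ((\<phi> (?c t) - 1) / of_real t) < norm D + 1"
      by (rule order_tendstoD) simp
    have "\<forall>\<^sub>F t in at_right (0::real). False"
      using A B small
    proof eventually_elim
      case (elim t)
      have "1 - norm_inf (?c t) = t"
        using elim by (simp add: norm_inf_def scaleR_conv_of_real nrm)
      then have "norm D + 1 < (1 - norm (\<phi> (?c t))) / t" using elim by simp
      also have "\<dots> \<le> norm (\<phi> (?c t) - 1) / t"
        using elim norm_triangle_ineq2[of 1 "\<phi> (?c t)"]
        by (intro divide_right_mono) (auto simp: norm_minus_commute)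
      finally show ?case using elim by (simp add: norm_divide)
    qed
    then show False by simp
  qed
  then show ?thesis by (simp add: carapoint_def torus2_def less_top top_ereal_def)
qed

section \<open>Nontangential approach\<close>

text \<open>Moving a single coordinate radially to the unit circle reaches the frontier.\<close>

lemma infdist_frontier_bidisc_le:
  assumes "p \<in> bidisc"
  shows "infdist p (frontier bidisc) \<le> 1 - norm (fst p)"
    and "infdist p (frontier bidisc) \<le> 1 - norm (snd p)"
proof -
  have fr: "frontier bidisc = cball 0 1 \<times> cball 0 1 - ball 0 1 \<times> (ball 0 1 :: complex set)"
    by (simp add: bidisc_def frontier_def closure_Times interior_Times)
  have ex: "\<exists>u. norm u = 1 \<and> dist z u = 1 - norm z" if "norm z < 1" for z :: complex
  proof (cases "z = 0")
    case False
    have "norm (z - sgn z) = norm (of_real (norm z - 1) * sgn z)"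
      using False by (simp add: sgn_div_norm scaleR_conv_of_real field_simps)
    also have "\<dots> = 1 - norm z" using False that by (simp only: norm_mult norm_of_real norm_sgn) simp
    finally show ?thesis using False by (intro exI[of _ "sgn z"]) (simp add: dist_norm norm_sgn)
  qed (auto intro!: exI[of _ 1])
  obtain a b where p: "p = (a, b)" "norm a < 1" "norm b < 1"
    using assms by (auto simp: bidisc_def)
  obtain u v where u: "norm u = 1" "dist a u = 1 - norm a" and v: "norm v = 1" "dist b v = 1 - norm b"
    using ex p by metis
  have "infdist p (frontier bidisc) \<le> dist p (u, b)"
    using u p by (intro infdist_le) (auto simp: fr)
  then show "infdist p (frontier bidisc) \<le> 1 - norm (fst p)"
    using u p by (simp add: dist_Pair_Pair)
  have "infdist p (frontier bidisc) \<le> dist p (a, v)"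
    using v p by (intro infdist_le) (auto simp: fr)
  then show "infdist p (frontier bidisc) \<le> 1 - norm (snd p)"
    using v p by (simp add: dist_Pair_Pair)
qed

lemma approaches_nontangentially_bound:
  assumes "approaches_nontangentially S (1, 1)"
  obtains K where "K > 0" and
    "\<And>p. p \<in> S \<Longrightarrow> p \<in> bidisc \<and> norm (p - (1, 1)) \<le> K * (1 - norm (fst p)) \<and>
       norm (p - (1, 1)) \<le> K * (1 - norm (snd p))"
proof -
  obtain K where K: "K > 0" "\<And>p. p \<in> S \<Longrightarrow> norm (norm (p - (1, 1)) / infdist p (frontier bidisc)) \<le> K"
    using assms unfolding approaches_nontangentially_def bounded_pos by auto
  have sub: "S \<subseteq> bidisc" using assms by (simp add: approaches_nontangentially_def)
  have "open bidisc" by (simp add: bidisc_def open_Times)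
  \<comment> \<open>\<open>infdist\<close> to the empty set is 0 by convention, and division by 0
    gives 0. The distance must therefore be shown positive before the bounded quotient can be
    multiplied out.\<close>
  have ne: "frontier bidisc \<noteq> {}"
  proof -
    have "(1, 0) \<in> frontier bidisc"
      by (simp add: bidisc_def frontier_def closure_Times interior_Times)
    then show ?thesis by auto
  qed
  have "p \<in> bidisc \<and> norm (p - (1, 1)) \<le> K * (1 - norm (fst p)) \<and>
       norm (p - (1, 1)) \<le> K * (1 - norm (snd p))" if p: "p \<in> S" for p
  proof -
    have pb: "p \<in> bidisc" using sub p by auto
    have "p \<notin> frontier bidisc"
      using pb \<open>open bidisc\<close> by (simp add: frontier_def interior_open)
    then have pos: "infdist p (frontier bidisc) > 0"
      using ne by (intro infdist_pos_not_in_closed) auto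
    then have le: "norm (p - (1, 1)) \<le> K * infdist p (frontier bidisc)"
      using K(2)[OF p] by (simp add: field_simps)
    show ?thesis
      using pb infdist_frontier_bidisc_le[OF pb] K(1)
      by (auto intro: order_trans[OF le] mult_left_mono)
  qed
  then show ?thesis using that K(1) by blast
qed

text \<open>In the formula for \<open>Re (cayley z)\<close> the numerator is at least
  \<open>1 - norm z\<close> and the denominator at most 4.\<close>

lemma Re_cayley_ge:
  assumes "norm z < 1"
  shows "1 - norm z \<le> 4 * Re (cayley z)"
proof -
  have "norm (1 + z) \<le> 2" using norm_triangle_ineq[of 1 z] assms by simp
  then have "(norm (1 + z))\<^sup>2 \<le> 2\<^sup>2" by (rule power_mono) simp
  moreover have "(norm (1 + z))\<^sup>2 > 0" using one_plus_nonzero[OF assms] by simp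
  moreover have "(norm z)\<^sup>2 \<le> norm z"
    using assms by (simp add: power2_eq_square mult_left_le)
  ultimately have "(1 - norm z) * (norm (1 + z))\<^sup>2 \<le> (1 - (norm z)\<^sup>2) * 4"
    using assms by (intro mult_mono) auto
  then show ?thesis
    unfolding Re_cayley using \<open>(norm (1 + z))\<^sup>2 > 0\<close> by (simp add: field_simps)
qed

lemma norm_cayley_le:
  assumes "dist z 1 < 1"
  shows "norm (cayley z) \<le> norm (z - 1)"
proof -
  have "norm (1 + z) \<ge> 1"
    using norm_triangle_ineq2[of 2 "1 - z"] assms by (simp add: dist_norm norm_minus_commute)
  then have "norm (1 - z) / norm (1 + z) \<le> norm (1 - z) / 1"
    by (intro divide_left_mono) auto
  then show ?thesis by (simp add: cayley_def norm_divide norm_minus_commute)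
qed

text \<open>On a nontangential set both Cayley coordinates have norm at most \<open>4 * K\<close>
  times either real part. The linear bound with \<open>N = 4 * K\<close> then makes the homogeneous
  function tend to 0, and the Cayley transform of 0 is 1.\<close>

lemma model_has_nontangential_limit:
  assumes g: "g holomorphic_on (- \<real>\<^sub>\<le>\<^sub>0)"
  shows "has_nontangential_limit (model g) (1, 1) 1"
  unfolding has_nontangential_limit_def
proof (intro allI impI)
  fix S assume "approaches_nontangentially S (1, 1)"
  then obtain K where K: "K > 0" and S: "\<And>p. p \<in> S \<Longrightarrow> p \<in> bidisc \<and>
      norm (p - (1, 1)) \<le> K * (1 - norm (fst p)) \<and> norm (p - (1, 1)) \<le> K * (1 - norm (snd p))"
    by (rule approaches_nontangentially_bound) blast
  obtain M where M: "\<And>a b. a \<noteq> 0 \<Longrightarrow> norm a \<le> 4 * K * Re a \<Longrightarrow> norm a \<le> 4 * K * Re b \<Longrightarrow>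
      norm b \<le> 4 * K * Re a \<Longrightarrow> norm (hom_ext g (a, b)) \<le> M * norm a"
    using hom_ext_linear_bound[OF g, of "4 * K"] K by auto
  let ?F = "at (1, 1) within S"
  let ?H = "\<lambda>p. hom_ext g (cayley (fst p), cayley (snd p))"
  have "\<forall>\<^sub>F p in ?F. norm (?H p) \<le> M * norm (cayley (fst p))"
    unfolding eventually_at
  \<comment> \<open>Radius 1 keeps each coordinate within distance 1 of the point 1, as
    \<open>norm_cayley_le\<close> demands.\<close>
  proof (intro exI[of _ 1] conjI ballI impI)
    fix p assume p: "p \<in> S" and near: "p \<noteq> (1, 1) \<and> dist p (1, 1) < 1"
    obtain x y where xy: "p = (x, y)" by (cases p)
    have n: "norm x < 1" "norm y < 1" using S[OF p] by (auto simp: xy bidisc_def)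
    have x1: "norm (x - 1) \<le> norm (p - (1, 1))" and y1: "norm (y - 1) \<le> norm (p - (1, 1))"
      using norm_fst_le[of "x - 1" "y - 1"] norm_snd_le[of "y - 1" "x - 1"] by (auto simp: xy)
    have cx: "norm (cayley x) \<le> norm (p - (1, 1))"
      using norm_cayley_le[of x] x1 near by (simp add: dist_norm)
    have cy: "norm (cayley y) \<le> norm (p - (1, 1))"
      using norm_cayley_le[of y] y1 near by (simp add: dist_norm)
    have "K * (1 - norm x) \<le> K * (4 * Re (cayley x))" "K * (1 - norm y) \<le> K * (4 * Re (cayley y))"
      using K Re_cayley_ge n by (simp_all add: mult_left_mono)
    then have rx: "norm (p - (1, 1)) \<le> 4 * K * Re (cayley x)"
      and ry: "norm (p - (1, 1)) \<le> 4 * K * Re (cayley y)"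
      using S[OF p] by (auto simp: xy)
    have "cayley x \<noteq> 0" using Re_cayley_pos[OF n(1)] by auto
    then show "norm (?H p) \<le> M * norm (cayley (fst p))"
      using M[of "cayley x" "cayley y"] cx cy rx ry by (simp add: xy)
  qed simp
  moreover have "((\<lambda>p. M * norm (cayley (fst p))) \<longlongrightarrow> 0) ?F"
    unfolding cayley_def by (auto intro!: tendsto_eq_intros)
  ultimately have H: "(?H \<longlongrightarrow> 0) ?F"
    by (rule Lim_null_comparison)
  show "(model g \<longlongrightarrow> 1) ?F"
    unfolding model_def cayley_def[of "hom_ext g _"]
    by (rule tendsto_eq_intros H | simp)+
qed

theorem theorem6p2:
  fixes h :: "complex \<Rightarrow> complex"
  assumes "h \<in> pick_class"
    and "(\<lambda>z. - z * h z) \<in> pick_class"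
  shows "\<exists>\<phi>\<in>schur_class2. carapoint \<phi> (1, 1) \<and> has_nontangential_limit \<phi> (1, 1) 1 \<and>
           slope_function h \<phi> (1, 1)"
proof -
  obtain g where g: "slit_plane_extension h g"
    and sym: "\<And>z. z \<in> - \<real>\<^sub>\<le>\<^sub>0 \<Longrightarrow> g (cnj z) = cnj (g z)"
    using pick_pair_extension[OF assms] by blast
  have hol: "g holomorphic_on (- \<real>\<^sub>\<le>\<^sub>0)" using g by (simp add: slit_plane_extension_def)
  have schur: "model g \<in> schur_class2"
    by (intro model_schur_class2 hol hom_ext_Re_nonneg[OF assms g sym])
  \<comment> \<open>The minus sign in \<open>hom_ext\<close> cancels the one in the derivative,
    leaving the slope formula with \<open>w = 1\<close> and trivial conjugate factors.\<close>
  have der: "has_inward_derivative (model g) (1, 1) 1 \<delta> (snd \<delta> * g (snd \<delta> / fst \<delta>))"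
    if "\<delta> \<in> inward_directions (1, 1)" for \<delta>
    using model_has_inward_derivative[OF hol that] by (simp add: hom_ext_def)
  have cara: "carapoint (model g) (1, 1)"
    by (rule has_inward_derivative_imp_carapoint, rule der) (simp add: inward_directions_one)
  have lim: "has_nontangential_limit (model g) (1, 1) 1"
    by (rule model_has_nontangential_limit[OF hol])
  have "slope_function h (model g) (1, 1)"
    unfolding slope_function_def using assms cara lim g der
    by (intro conjI exI[of _ 1] exI[of _ g]) auto
  then show ?thesis using schur cara lim by blast
qed

end
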